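(* Let $\alpha>0$, $\alpha\ne1$. Let $\Pi=\{p_\theta:\theta\in\Theta\subset\mathbb{R}\}$ be a family of probability distributions with common support $\mathbb{S}\subset\mathbb{R}$. Consider the deformed family $\Pi^*=\{p_\theta^*\}$ of $\Pi$, where $p_\theta^*$ is the deformed probability distribution on $\mathbb{S}^n$ associated with the Jones et al. likelihood function $L_J^{(\alpha)}$. Let $\widehat\theta=\widehat\theta(x_1^n)$ be an unbiased estimator of its expected value with respect to $p_\theta^*$, and let $\tau^*(\theta)=\mathbb{E}_\theta^*[\widehat\theta]$. Suppose $T$ is a sufficient statistic for $\theta$ with respect to $L_J^{(\alpha)}$, and let $\phi^*(T)=\mathbb{E}_\theta^*[\widehat\theta|T]$. Then $\phi^*(T)$ is a uniformly better estimator of $\tau^*(\theta)$ than $\widehat\theta$, that is, for all $\theta\in\Theta$: (a) $\mathbb{E}_\theta^*[\phi^*(T)]=\tau^*(\theta)$; (b) $\mathrm{Var}_\theta^*[\phi^*(T(X_1^n))]\le\mathrm{Var}_\theta^*[\widehat\theta(X_1^n)]$, and equality holds if and only if $\widehat\theta$ is a function of the sufficient statistic $T$.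
   Context: The Jones et al. likelihood function is $$L_J^{(\alpha)}(x_1^n;\theta)=\frac{1}{\alpha-1}\log\Big[\frac1n\sum_{i=1}^n p_\theta(x_i)^{\alpha-1}\Big]-\frac1\alpha\log\Big[\int p_\theta(x)^\alpha dx\Big].$$ The associated deformed probability distribution on $\mathbb{S}^n$ is $$p_\theta^*(x_1^n)=\frac{\exp[L_J^{(\alpha)}(x_1^n;\theta)]}{\int\exp[L_J^{(\alpha)}(y_1^n;\theta)]dy_1^n}=\frac{\big(\frac1n\sum_{i=1}^n p_\theta(x_i)^{\alpha-1}\big)^{\frac1{\alpha-1}}}{\int\big(\frac1n\sum_{i=1}^n p_\theta(y_i)^{\alpha-1}\big)^{\frac1{\alpha-1}}dy_1^n},$$ assuming the denominator is finite. Integrals are replaced by sums for discrete distributions. $\mathbb{E}_\theta^*$, $\mathrm{Var}_\theta^*$ denote expectation and variance with respect to $p_\theta^*$. Sufficiency: $T$ is sufficient for $\theta$ with respect to $L_J^{(\alpha)}$ if, whenever $T(x_1^n)=T(y_1^n)$, $L_J^{(\alpha)}(x_1^n;\theta)-L_J^{(\alpha)}(y_1^n;\theta)$ is independent of $\theta\in\Theta$. Conditional distribution: for a value $t$ of $T$, let $A_t=\{x_1^n:T(x_1^n)=t\}$, $q_\theta^*(t)=\int_{A_t}p_\theta^*(y_1^n)dy_1^n$ (integration over the fibre $A_t$; a sum in the discrete case; implicitly $0<q^*_\theta(t)<\infty$), and $p^*_{\theta_{X_1^n|T}}(x_1^n|t)=p_\theta^*(x_1^n)/q_\theta^*(t)$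 if $x_1^n\in A_t$, and $0$ otherwise. The conditional expectation is $\mathbb{E}_\theta^*[\widehat\theta|T=t]=\int\widehat\theta(y_1^n)\,p^*_{\theta_{X_1^n|T}}(y_1^n|t)\,dy_1^n$; for $T$ sufficient it does not depend on $\theta$, so $\phi^*(T)$ is a function of $T$ alone.
   Formalization: Part (b) is stated for θ at which the estimator has finite variance (with infinite variances the equality criterion fails), "function of T" means almost everywhere, and integration over the fibres of T is taken with respect to a disintegration of the reference measure on the sample space. *)

theory Defs
  imports "HOL-Probability.Probability"
begin

text \<open>
  Samples of size \<open>n\<close> are extensional functions on \<open>{..<n}\<close>. The reference measure \<open>M\<close> on the
  common support is Lebesgue measure for densities and counting measure for mass functions.
\<close>

abbreviation sample_measure :: "real measure \<Rightarrow> nat \<Rightarrow> (nat \<Rightarrow> real) measure" where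
  "sample_measure M n \<equiv> PiM {..<n} (\<lambda>_. M)"

definition jones_likelihood ::
  "real \<Rightarrow> real measure \<Rightarrow> nat \<Rightarrow> (real \<Rightarrow> real \<Rightarrow> real) \<Rightarrow> (nat \<Rightarrow> real) \<Rightarrow> real \<Rightarrow> real" where
  "jones_likelihood \<alpha> M n p x \<theta> =
     1 / (\<alpha> - 1) * ln (1 / real n * (\<Sum>i<n. p \<theta> (x i) powr (\<alpha> - 1)))
     - 1 / \<alpha> * ln (\<integral>y. p \<theta> y powr \<alpha> \<partial>M)"

text \<open>
  The second term of the likelihood does not depend on the sample: it cancels in the normalised
  density below and in the differences defining sufficiency. Hence the convention
  \<open>ln 0 = 0\<close> used when the integral of \<open>p\<^sub>\<theta>\<close> to the power \<open>\<alpha>\<close>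
  diverges affects neither notion.
\<close>

definition deformed_pdf ::
  "real \<Rightarrow> real measure \<Rightarrow> nat \<Rightarrow> (real \<Rightarrow> real \<Rightarrow> real) \<Rightarrow> real \<Rightarrow> (nat \<Rightarrow> real) \<Rightarrow> real" where
  "deformed_pdf \<alpha> M n p \<theta> x =
     exp (jones_likelihood \<alpha> M n p x \<theta>) /
     (\<integral>y. exp (jones_likelihood \<alpha> M n p y \<theta>) \<partial>sample_measure M n)"

definition deformed_dist ::
  "real \<Rightarrow> real measure \<Rightarrow> nat \<Rightarrow> (real \<Rightarrow> real \<Rightarrow> real) \<Rightarrow> real \<Rightarrow> (nat \<Rightarrow> real) measure" where
  "deformed_dist \<alpha> M n p \<theta> =
     density (sample_measure M n) (\<lambda>x. ennreal (deformed_pdf \<alpha> M n p \<theta> x))"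

definition jones_sufficient ::
  "real \<Rightarrow> real measure \<Rightarrow> nat \<Rightarrow> (real \<Rightarrow> real \<Rightarrow> real) \<Rightarrow> real set \<Rightarrow> ((nat \<Rightarrow> real) \<Rightarrow> 't) \<Rightarrow> bool" where
  "jones_sufficient \<alpha> M n p \<Theta> T \<longleftrightarrow>
     (\<forall>x\<in>space (sample_measure M n). \<forall>y\<in>space (sample_measure M n). T x = T y \<longrightarrow>
        (\<exists>c. \<forall>\<theta>\<in>\<Theta>. jones_likelihood \<alpha> M n p x \<theta> - jones_likelihood \<alpha> M n p y \<theta> = c))"

definition fibre :: "'a measure \<Rightarrow> ('a \<Rightarrow> 't) \<Rightarrow> 't \<Rightarrow> 'a set" where
  "fibre \<mu> T t = {x \<in> space \<mu>. T x = t}"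

text \<open>
  Fibres of a continuous statistic are Lebesgue null sets, so integration over the fibres of \<open>T\<close>
  refers to a disintegration of the sample measure \<open>\<mu>\<close>: \<open>\<kappa> t\<close> is the measure used on the fibre
  over \<open>t\<close>, and \<open>\<nu>\<close> is the measure on values of \<open>T\<close> with
  \<open>\<integral>f d\<mu> = \<integral>(\<integral>f d\<kappa>\<^sub>t) d\<nu>(t)\<close>. For mass functions these are
  counting measures; see \<open>fibre_integration_count_space\<close> below.
\<close>

definition fibre_integration ::
  "'a measure \<Rightarrow> ('a \<Rightarrow> 't) \<Rightarrow> 't measure \<Rightarrow> ('t \<Rightarrow> 'a measure) \<Rightarrow> bool" where
  "fibre_integration \<mu> T \<nu> \<kappa> \<longleftrightarrow>
     T \<in> measurable \<mu> \<nu> \<and>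
     (\<forall>t\<in>space \<nu>. {t} \<in> sets \<nu>) \<and>
     (\<forall>t\<in>space \<nu>. sets (\<kappa> t) = sets \<mu> \<and> emeasure (\<kappa> t) (space \<mu> - fibre \<mu> T t) = 0) \<and>
     (\<forall>A\<in>sets \<mu>. (\<lambda>t. emeasure (\<kappa> t) A) \<in> borel_measurable \<nu> \<and>
        emeasure \<mu> A = (\<integral>\<^sup>+t. emeasure (\<kappa> t) A \<partial>\<nu>))"

definition deformed_statistic_pdf ::
  "real \<Rightarrow> real measure \<Rightarrow> nat \<Rightarrow> (real \<Rightarrow> real \<Rightarrow> real) \<Rightarrow> ((nat \<Rightarrow> real) \<Rightarrow> 't) \<Rightarrow>
   ('t \<Rightarrow> (nat \<Rightarrow> real) measure) \<Rightarrow> real \<Rightarrow> 't \<Rightarrow> real" where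
  "deformed_statistic_pdf \<alpha> M n p T \<kappa> \<theta> t =
     (LINT y:fibre (sample_measure M n) T t|\<kappa> t. deformed_pdf \<alpha> M n p \<theta> y)"

definition deformed_cond_pdf ::
  "real \<Rightarrow> real measure \<Rightarrow> nat \<Rightarrow> (real \<Rightarrow> real \<Rightarrow> real) \<Rightarrow> ((nat \<Rightarrow> real) \<Rightarrow> 't) \<Rightarrow>
   ('t \<Rightarrow> (nat \<Rightarrow> real) measure) \<Rightarrow> real \<Rightarrow> (nat \<Rightarrow> real) \<Rightarrow> 't \<Rightarrow> real" where
  "deformed_cond_pdf \<alpha> M n p T \<kappa> \<theta> x t =
     (if x \<in> fibre (sample_measure M n) T t
      then deformed_pdf \<alpha> M n p \<theta> x / deformed_statistic_pdf \<alpha> M n p T \<kappa> \<theta> t else 0)"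

definition deformed_cond_exp ::
  "real \<Rightarrow> real measure \<Rightarrow> nat \<Rightarrow> (real \<Rightarrow> real \<Rightarrow> real) \<Rightarrow> ((nat \<Rightarrow> real) \<Rightarrow> 't) \<Rightarrow>
   ('t \<Rightarrow> (nat \<Rightarrow> real) measure) \<Rightarrow> real \<Rightarrow> ((nat \<Rightarrow> real) \<Rightarrow> real) \<Rightarrow> 't \<Rightarrow> real" where
  "deformed_cond_exp \<alpha> M n p T \<kappa> \<theta> X t =
     (\<integral>y. X y * deformed_cond_pdf \<alpha> M n p T \<kappa> \<theta> y t \<partial>\<kappa> t)"

lemma fibre_integration_count_space:
  fixes T :: "'a \<Rightarrow> 't"
  assumes "countable A"
  shows "fibre_integration (count_space A) T (count_space (T ` A))
           (\<lambda>t. density (count_space A) (indicator (fibre (count_space A) T t)))"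
proof -
  have em: "emeasure (density (count_space A) (indicator (fibre (count_space A) T t))) B
      = (\<integral>\<^sup>+x. indicator (fibre (count_space A) T t) x * indicator B x \<partial>count_space A)"
    if "B \<subseteq> A" for t B
    using that by (subst emeasure_density) auto
  have pair: "pair_sigma_finite (count_space A) (count_space (T ` A))"
    using assms
    by (intro pair_sigma_finite.intro sigma_finite_measure_count_space_countable) auto
  have tot: "emeasure (count_space A) B =
      (\<integral>\<^sup>+t. emeasure (density (count_space A) (indicator (fibre (count_space A) T t))) B
         \<partial>count_space (T ` A))" if B: "B \<subseteq> A" for B
  proof -
    have one: "(\<integral>\<^sup>+t. indicator (fibre (count_space A) T t) x * indicator B x \<partial>count_space (T ` A))
        = (indicator B x :: ennreal)" if x: "x \<in> A" for x
    proof -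
      have "(\<integral>\<^sup>+t. indicator (fibre (count_space A) T t) x * indicator B x \<partial>count_space (T ` A))
          = (\<integral>\<^sup>+t. indicator B x * indicator {T x} t \<partial>count_space (T ` A))"
        by (intro nn_integral_cong) (use x in \<open>auto simp: fibre_def indicator_def\<close>)
      also have "\<dots> = indicator B x"
        using x by (subst nn_integral_cmult_indicator) auto
      finally show ?thesis .
    qed
    have "emeasure (count_space A) B = (\<integral>\<^sup>+x. indicator B x \<partial>count_space A)"
      using B by simp
    also have "\<dots> = (\<integral>\<^sup>+x. (\<integral>\<^sup>+t. indicator (fibre (count_space A) T t) x * indicator B x
        \<partial>count_space (T ` A)) \<partial>count_space A)"
      by (intro nn_integral_cong) (simp add: one)
    also have "\<dots> = (\<integral>\<^sup>+t. (\<integral>\<^sup>+x. indicator (fibre (count_space A) T t) x * indicator B x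
        \<partial>count_space A) \<partial>count_space (T ` A))"
      using assms
      by (intro pair_sigma_finite.Fubini'[OF pair, symmetric])
        (simp add: pair_measure_countable)
    finally show ?thesis
      by (simp add: em[OF B])
  qed
  have "emeasure (density (count_space A) (indicator (fibre (count_space A) T t)))
      (A - fibre (count_space A) T t) = 0" for t
    by (subst em) (auto simp: nn_integral_0_iff_AE AE_count_space indicator_def)
  with tot show ?thesis
    unfolding fibre_integration_def by auto
qed

lemma sample_measure_count_space:
  assumes "countable S"
  shows "sample_measure (count_space S) n = count_space ({..<n} \<rightarrow>\<^sub>E S)"
proof -
  interpret product_sigma_finite "\<lambda>_::nat. count_space S"
    using assms
    by (intro product_sigma_finite.intro sigma_finite_measure_count_space_countable)
  have c: "countable ({..<n} \<rightarrow>\<^sub>E S)"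
    using assms by (intro countable_PiE) auto
  have eq: "{x} = (\<Pi>\<^sub>E i\<in>{..<n}. {x i})" if "x \<in> {..<n} \<rightarrow>\<^sub>E S" for x
    using that by (intro PiE_singleton[symmetric]) (simp add: PiE_iff)
  have xi: "x i \<in> S" if "x \<in> {..<n} \<rightarrow>\<^sub>E S" "i \<in> {..<n}" for x i
    using that by (rule PiE_mem)
  have meas: "{x} \<in> sets (sample_measure (count_space S) n)" if x: "x \<in> {..<n} \<rightarrow>\<^sub>E S" for x
  proof -
    have "(\<Pi>\<^sub>E i\<in>{..<n}. {x i}) \<in> sets (sample_measure (count_space S) n)"
      using xi[OF x] by (intro sets_PiM_I_finite) simp_all
    then show ?thesis
      by (simp only: eq[OF x, symmetric])
  qed
  have sets: "sets (sample_measure (count_space S) n) = Pow ({..<n} \<rightarrow>\<^sub>E S)"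
  proof
    show "sets (sample_measure (count_space S) n) \<subseteq> Pow ({..<n} \<rightarrow>\<^sub>E S)"
      using sets.sets_into_space[of _ "sample_measure (count_space S) n"]
      by (auto simp: space_PiM)
    show "Pow ({..<n} \<rightarrow>\<^sub>E S) \<subseteq> sets (sample_measure (count_space S) n)"
    proof
      fix B assume "B \<in> Pow ({..<n} \<rightarrow>\<^sub>E S)"
      then have B: "B \<subseteq> {..<n} \<rightarrow>\<^sub>E S" by simp
      have "(\<Union>x\<in>B. {x}) \<in> sets (sample_measure (count_space S) n)"
        using B meas countable_subset[OF B c] by (intro sets.countable_UN') auto
      then show "B \<in> sets (sample_measure (count_space S) n)" by simp
    qed
  qed
  show ?thesis
  proof (rule measure_eqI_countable[OF sets _ c])
    fix x assume x: "x \<in> {..<n} \<rightarrow>\<^sub>E S"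
    have "emeasure (sample_measure (count_space S) n) {x}
        = emeasure (sample_measure (count_space S) n) (\<Pi>\<^sub>E i\<in>{..<n}. {x i})"
      by (simp only: eq[OF x, symmetric])
    also have "\<dots> = (\<Prod>i<n. emeasure (count_space S) {x i})"
      using xi[OF x] by (intro emeasure_PiM) simp_all
    also have "\<dots> = 1"
      using xi[OF x] by (intro prod.neutral) simp
    finally show "emeasure (sample_measure (count_space S) n) {x}
        = emeasure (count_space ({..<n} \<rightarrow>\<^sub>E S)) {x}"
      using x by simp
  qed simp
qed

end

theory Submission
  imports Defs
begin

text \<open>
  Sufficiency makes the ratio of two deformed densities constant on each fibre of \<open>T\<close>; the constant
  cancels in the conditional density, so \<open>\<phi>\<close> may be computed at any parameter. For the
  estimator \<open>X\<close> and the deformed density \<open>f\<close> at that parameter, \<open>\<phi>\<close> is the quotient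
  of the fibre integrals of \<open>X f\<close> and of \<open>f\<close>, and the disintegration formula
  shows that its composition with \<open>T\<close> is a version of the conditional expectation of \<open>X\<close>
  given the sigma-algebra generated by \<open>T\<close>. As in the classical Rao-Blackwell theorem, the variances
  then differ by the mean square of \<open>X - \<phi> \<circ> T\<close>.
\<close>

section \<open>Conditional expectation and reduction of variance\<close>

text \<open>Conditional expectation is an orthogonal projection in L^2: \<open>X - Y\<close> is
  orthogonal to \<open>Y\<close> and both variables have the same mean, so the mean of
  \<open>(X - Y)^2\<close> is the difference of the variances. \<open>Y\<close> may be any version,
  because the application supplies an explicit formula instead of
  \<open>real_cond_exp\<close>.\<close>

lemma (in prob_space) rao_blackwell:
  fixes X Y :: "'a \<Rightarrow> real"
  assumes F: "subalgebra M F"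
    and Y: "Y \<in> borel_measurable F" "AE x in M. real_cond_exp M F X x = Y x"
    and X: "integrable M X" "integrable M (\<lambda>x. (X x)\<^sup>2)"
  shows "integrable M (\<lambda>x. (Y x)\<^sup>2)"
    and "variance Y \<le> variance X"
    and "variance Y = variance X \<longleftrightarrow> (AE x in M. X x = Y x)"
proof -
  interpret finite_measure_subalgebra M F
    by (intro finite_measure_subalgebra.intro finite_measure_subalgebra_axioms.intro F finite_measure_axioms)
  let ?C = "real_cond_exp M F X"
  have [measurable]: "X \<in> borel_measurable M" using X by auto
  have [measurable]: "Y \<in> borel_measurable M"
    using F Y(1) by (rule measurable_from_subalg)
  \<comment> \<open>By Jensen's inequality the square of the conditional expectation is dominated by
    the conditional expectation of \<open>X^2\<close>; this is how square integrability passes from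
    \<open>X\<close> to \<open>Y\<close>.\<close>
  have "integrable M (\<lambda>x. (?C x)\<^sup>2)"
    by (rule integrable_convex_cond_exp[where I=UNIV and q="\<lambda>x. x\<^sup>2"]) (use X in \<open>auto intro: convex_power2\<close>)
  moreover have "integrable M (\<lambda>x. (?C x)\<^sup>2) \<longleftrightarrow> integrable M (\<lambda>x. (Y x)\<^sup>2)"
    using Y(2) by (intro integrable_cong_AE) auto
  ultimately show Y2: "integrable M (\<lambda>x. (Y x)\<^sup>2)" by simp
  have Yi: "integrable M Y"
    by (rule square_integrable_imp_integrable[OF _ Y2]) measurable
  have YX: "integrable M (\<lambda>x. Y x * X x)"
  proof (rule Bochner_Integration.integrable_bound[OF Bochner_Integration.integrable_add[OF Y2 X(2)]])
    show "AE x in M. norm (Y x * X x) \<le> norm ((Y x)\<^sup>2 + (X x)\<^sup>2)"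
    proof (rule AE_I2)
      fix x
      have "\<bar>Y x\<bar> * \<bar>X x\<bar> \<le> (Y x)\<^sup>2 + (X x)\<^sup>2"
        using sum_squares_bound[of "\<bar>Y x\<bar>" "\<bar>X x\<bar>"] abs_ge_zero[of "Y x * X x"]
        unfolding abs_mult power2_abs mult.assoc by linarith
      then show "norm (Y x * X x) \<le> norm ((Y x)\<^sup>2 + (X x)\<^sup>2)"
        by (simp add: abs_mult)
    qed
  qed simp
  \<comment> \<open>\<open>Y\<close> is measurable with respect to \<open>F\<close>, so next to it
    \<open>X\<close> may be replaced by its projection \<open>?C\<close>, which is almost surely
    \<open>Y\<close> again.\<close>
  have "expectation (\<lambda>x. Y x * X x) = expectation (\<lambda>x. Y x * ?C x)"
    by (rule real_cond_exp_intg(2)[OF YX Y(1), symmetric]) measurable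
  also have "\<dots> = expectation (\<lambda>x. (Y x)\<^sup>2)"
    using Y(2) by (intro integral_cong_AE) (auto simp: power2_eq_square)
  finally have eYX: "expectation (\<lambda>x. Y x * X x) = expectation (\<lambda>x. (Y x)\<^sup>2)" .
  have eY: "expectation Y = expectation X"
  proof -
    have "expectation Y = expectation ?C"
      using Y(2) by (intro integral_cong_AE) auto
    then show ?thesis
      by (simp only: real_cond_exp_int(2)[OF X(1)])
  qed
  have D: "integrable M (\<lambda>x. (X x - Y x)\<^sup>2)"
    using X(2) Y2 YX by (simp add: power2_diff mult.assoc mult.commute[of "X _"])
  have "expectation (\<lambda>x. (X x - Y x)\<^sup>2) = expectation (\<lambda>x. (X x)\<^sup>2 + (Y x)\<^sup>2 - 2 * (Y x * X x))"
    by (simp add: power2_diff mult.assoc mult.commute[of "X _"])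
  also have "\<dots> = variance X - variance Y"
    unfolding variance_eq[OF X] variance_eq[OF Yi Y2] using X Y2 YX eYX eY by simp
  finally have eD: "expectation (\<lambda>x. (X x - Y x)\<^sup>2) = variance X - variance Y" .
  moreover have "expectation (\<lambda>x. (X x - Y x)\<^sup>2) \<ge> 0" by simp
  ultimately show "variance Y \<le> variance X" by simp
  have "variance Y = variance X \<longleftrightarrow> expectation (\<lambda>x. (X x - Y x)\<^sup>2) = 0"
    using eD by auto
  also have "\<dots> \<longleftrightarrow> (AE x in M. (X x - Y x)\<^sup>2 = 0)"
    using D by (intro integral_nonneg_eq_0_iff_AE) auto
  finally show "variance Y = variance X \<longleftrightarrow> (AE x in M. X x = Y x)" by simp
qed

section \<open>Integration along a disintegration\<close>

text \<open>A finite integral keeps \<open>g\<close> finite almost everywhere, so it does no harm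
  that \<open>enn2real\<close> sends infinity to 0. It serves for fibre integrals of positive and
  negative parts, which may be infinite on a null set of values \<open>t\<close>.\<close>

lemma integral_enn2real:
  assumes [measurable]: "g \<in> borel_measurable M" and fin: "(\<integral>\<^sup>+x. g x \<partial>M) < \<infinity>"
  shows "integrable M (\<lambda>x. enn2real (g x))"
    and "(LINT x|M. enn2real (g x)) = enn2real (\<integral>\<^sup>+x. g x \<partial>M)"
proof -
  have "AE x in M. g x \<noteq> \<infinity>"
    using fin by (intro nn_integral_noteq_infinite) auto
  then have eq: "(\<integral>\<^sup>+x. ennreal (enn2real (g x)) \<partial>M) = (\<integral>\<^sup>+x. g x \<partial>M)"
    by (intro nn_integral_cong_AE) (auto simp: less_top)
  then show "integrable M (\<lambda>x. enn2real (g x))"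
    using fin by (intro integrableI_nonneg) auto
  show "(LINT x|M. enn2real (g x)) = enn2real (\<integral>\<^sup>+x. g x \<partial>M)"
    using eq by (subst integral_eq_nn_integral) auto
qed

locale disintegration =
  fixes \<mu> :: "'a measure" and T :: "'a \<Rightarrow> 't" and \<nu> :: "'t measure" and \<kappa> :: "'t \<Rightarrow> 'a measure"
  assumes fibre_integration: "fibre_integration \<mu> T \<nu> \<kappa>"
begin

lemma T_measurable [measurable]: "T \<in> measurable \<mu> \<nu>"
  and sets_kernel [measurable_cong]: "t \<in> space \<nu> \<Longrightarrow> sets (\<kappa> t) = sets \<mu>"
  and emeasure_kernel_measurable [measurable]:
    "A \<in> sets \<mu> \<Longrightarrow> (\<lambda>t. emeasure (\<kappa> t) A) \<in> borel_measurable \<nu>"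
  and emeasure_disintegration: "A \<in> sets \<mu> \<Longrightarrow> emeasure \<mu> A = (\<integral>\<^sup>+t. emeasure (\<kappa> t) A \<partial>\<nu>)"
  using fibre_integration by (auto simp: fibre_integration_def)

lemma space_kernel: "t \<in> space \<nu> \<Longrightarrow> space (\<kappa> t) = space \<mu>"
  using sets_kernel by (rule sets_eq_imp_space_eq)

lemma measurable_kernel: "t \<in> space \<nu> \<Longrightarrow> f \<in> measurable \<mu> N \<Longrightarrow> f \<in> measurable (\<kappa> t) N"
  using sets_kernel by (subst measurable_cong_sets) auto

text \<open>Measurability of the singleton \<open>{t}\<close> makes the fibre a measurable set, so
  its complement is a null set of \<open>\<kappa> t\<close>.\<close>

lemma AE_kernel_fibre:
  assumes t: "t \<in> space \<nu>"
  shows "AE y in \<kappa> t. T y = t"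
proof -
  have "{t} \<in> sets \<nu>" and null: "emeasure (\<kappa> t) (space \<mu> - fibre \<mu> T t) = 0"
    using fibre_integration t by (auto simp: fibre_integration_def)
  then have "T -` {t} \<inter> space \<mu> \<in> sets \<mu>"
    by (intro measurable_sets[OF T_measurable])
  moreover have "T -` {t} \<inter> space \<mu> = fibre \<mu> T t"
    by (auto simp: fibre_def)
  ultimately have "space \<mu> - fibre \<mu> T t \<in> null_sets (\<kappa> t)"
    using null t by (auto simp: sets_kernel null_sets_def)
  then show ?thesis
    using t by (intro AE_I'[of "space \<mu> - fibre \<mu> T t"]) (auto simp: space_kernel fibre_def)
qed

text \<open>Induction over nonnegative measurable functions extends the formula from sets to
  functions. The kernels are controlled only for \<open>t \<in> space \<nu>\<close>, so each case
  rewrites the inner integral there and transfers measurability by congruence.\<close>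

lemma nn_integral_disintegration:
  assumes "h \<in> borel_measurable \<mu>"
  shows "(\<lambda>t. \<integral>\<^sup>+y. h y \<partial>\<kappa> t) \<in> borel_measurable \<nu>" (is "?M h")
    and "(\<integral>\<^sup>+x. h x \<partial>\<mu>) = (\<integral>\<^sup>+t. (\<integral>\<^sup>+y. h y \<partial>\<kappa> t) \<partial>\<nu>)" (is "?I h")
proof -
  from assms have "?M h \<and> ?I h"
  proof (induction rule: borel_measurable_induct)
    case (cong f g)
    have 1: "(\<integral>\<^sup>+y. f y \<partial>\<kappa> t) = (\<integral>\<^sup>+y. g y \<partial>\<kappa> t)" if "t \<in> space \<nu>" for t
      using that cong by (intro nn_integral_cong) (auto simp: space_kernel)
    have 2: "(\<integral>\<^sup>+x. f x \<partial>\<mu>) = (\<integral>\<^sup>+x. g x \<partial>\<mu>)"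
      using cong by (intro nn_integral_cong) auto
    have "?M f \<longleftrightarrow> ?M g" by (intro measurable_cong 1)
    moreover have "(\<integral>\<^sup>+t. (\<integral>\<^sup>+y. f y \<partial>\<kappa> t) \<partial>\<nu>) = (\<integral>\<^sup>+t. (\<integral>\<^sup>+y. g y \<partial>\<kappa> t) \<partial>\<nu>)"
      by (intro nn_integral_cong 1)
    ultimately show ?case using cong 2 by simp
  next
    case (set A)
    have 1: "(\<integral>\<^sup>+y. indicator A y \<partial>\<kappa> t) = emeasure (\<kappa> t) A" if "t \<in> space \<nu>" for t
      using set that by (simp add: sets_kernel)
    have "(\<integral>\<^sup>+t. (\<integral>\<^sup>+y. indicator A y \<partial>\<kappa> t) \<partial>\<nu>) = (\<integral>\<^sup>+t. emeasure (\<kappa> t) A \<partial>\<nu>)"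
      by (intro nn_integral_cong 1)
    moreover have "?M (indicator A) \<longleftrightarrow> (\<lambda>t. emeasure (\<kappa> t) A) \<in> borel_measurable \<nu>"
      by (intro measurable_cong 1)
    ultimately show ?case
      using set by (simp add: emeasure_disintegration)
  next
    case (mult u c)
    have 1: "(\<integral>\<^sup>+y. c * u y \<partial>\<kappa> t) = c * (\<integral>\<^sup>+y. u y \<partial>\<kappa> t)" if "t \<in> space \<nu>" for t
      using mult that by (intro nn_integral_cmult measurable_kernel)
    have "?M (\<lambda>x. c * u x) \<longleftrightarrow> (\<lambda>t. c * (\<integral>\<^sup>+y. u y \<partial>\<kappa> t)) \<in> borel_measurable \<nu>"
      by (intro measurable_cong 1)
    moreover have "(\<integral>\<^sup>+t. (\<integral>\<^sup>+y. c * u y \<partial>\<kappa> t) \<partial>\<nu>) = (\<integral>\<^sup>+t. c * (\<integral>\<^sup>+y. u y \<partial>\<kappa> t) \<partial>\<nu>)"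
      by (intro nn_integral_cong 1)
    moreover have "(\<lambda>t. c * (\<integral>\<^sup>+y. u y \<partial>\<kappa> t)) \<in> borel_measurable \<nu>"
      using mult.IH by (intro borel_measurable_times_ennreal) auto
    ultimately show ?case
      using mult by (simp add: nn_integral_cmult)
  next
    case (add u v)
    have 1: "(\<integral>\<^sup>+y. v y + u y \<partial>\<kappa> t) = (\<integral>\<^sup>+y. v y \<partial>\<kappa> t) + (\<integral>\<^sup>+y. u y \<partial>\<kappa> t)" if "t \<in> space \<nu>" for t
      using add that by (intro nn_integral_add measurable_kernel)
    have "?M (\<lambda>x. v x + u x) \<longleftrightarrow> (\<lambda>t. (\<integral>\<^sup>+y. v y \<partial>\<kappa> t) + (\<integral>\<^sup>+y. u y \<partial>\<kappa> t)) \<in> borel_measurable \<nu>"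
      by (intro measurable_cong 1)
    moreover have "(\<integral>\<^sup>+t. (\<integral>\<^sup>+y. v y + u y \<partial>\<kappa> t) \<partial>\<nu>)
        = (\<integral>\<^sup>+t. (\<integral>\<^sup>+y. v y \<partial>\<kappa> t) + (\<integral>\<^sup>+y. u y \<partial>\<kappa> t) \<partial>\<nu>)"
      by (intro nn_integral_cong 1)
    moreover have "(\<lambda>t. (\<integral>\<^sup>+y. v y \<partial>\<kappa> t) + (\<integral>\<^sup>+y. u y \<partial>\<kappa> t)) \<in> borel_measurable \<nu>"
      using add.IH by (intro borel_measurable_add) auto
    ultimately show ?case
      using add by (simp add: nn_integral_add)
  next
    case (seq U)
    have sup: "(SUP i. U i) y = (SUP i. U i y)" for y
      by (simp add: SUP_apply image_comp)
    have 1: "(\<integral>\<^sup>+y. (SUP i. U i) y \<partial>\<kappa> t) = (SUP i. \<integral>\<^sup>+y. U i y \<partial>\<kappa> t)" if "t \<in> space \<nu>" for t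
      unfolding sup using seq that by (intro nn_integral_monotone_convergence_SUP measurable_kernel)
    have "?M (SUP i. U i) \<longleftrightarrow> (\<lambda>t. SUP i. \<integral>\<^sup>+y. U i y \<partial>\<kappa> t) \<in> borel_measurable \<nu>"
      by (intro measurable_cong 1)
    moreover have "(\<lambda>t. SUP i. \<integral>\<^sup>+y. U i y \<partial>\<kappa> t) \<in> borel_measurable \<nu>"
      using seq.IH by (intro borel_measurable_SUP) auto
    ultimately have M: "?M (SUP i. U i)"
      by simp
    have "(\<integral>\<^sup>+t. (\<integral>\<^sup>+y. (SUP i. U i) y \<partial>\<kappa> t) \<partial>\<nu>) = (\<integral>\<^sup>+t. (SUP i. \<integral>\<^sup>+y. U i y \<partial>\<kappa> t) \<partial>\<nu>)"
      by (intro nn_integral_cong 1)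
    also have "\<dots> = (SUP i. \<integral>\<^sup>+t. (\<integral>\<^sup>+y. U i y \<partial>\<kappa> t) \<partial>\<nu>)"
      using seq by (intro nn_integral_monotone_convergence_SUP)
        (auto simp: incseq_def le_fun_def intro!: nn_integral_mono)
    also have "\<dots> = (SUP i. \<integral>\<^sup>+x. U i x \<partial>\<mu>)"
      using seq by simp
    also have "\<dots> = (\<integral>\<^sup>+x. (SUP i. U i) x \<partial>\<mu>)"
      unfolding sup using seq by (intro nn_integral_monotone_convergence_SUP[symmetric])
    finally show ?case using M by simp
  qed
  then show "?M h" "?I h" by auto
qed

text \<open>The kernel masses of a null set of \<mu> integrate to 0 over \<nu>, hence vanish for
  almost every \<open>t\<close>.\<close>

lemma AE_kernel:
  assumes "AE x in \<mu>. P x"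
  shows "AE t in \<nu>. AE y in \<kappa> t. P y"
proof -
  from assms obtain N where N: "{x \<in> space \<mu>. \<not> P x} \<subseteq> N" "N \<in> sets \<mu>" "emeasure \<mu> N = 0"
    by (auto elim: AE_E)
  have null: "AE t in \<nu>. emeasure (\<kappa> t) N = 0"
    using N by (simp add: emeasure_disintegration nn_integral_0_iff_AE)
  show ?thesis
  proof (rule AE_mp[OF null], rule AE_I2, rule impI)
    fix t assume t: "t \<in> space \<nu>" and "emeasure (\<kappa> t) N = 0"
    with N show "AE y in \<kappa> t. P y"
      by (intro AE_I'[of N]) (auto simp: null_sets_def sets_kernel space_kernel)
  qed
qed

text \<open>Converse of \<open>AE_kernel\<close>. Here the exceptional set itself has to be
  measurable, because the disintegration formula speaks of measurable sets only.\<close>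

lemma AE_kernel_imp_AE:
  assumes P: "Measurable.pred \<mu> P" and AE: "AE t in \<nu>. AE y in \<kappa> t. P y"
  shows "AE x in \<mu>. P x"
proof -
  let ?A = "{x \<in> space \<mu>. \<not> P x}"
  have A: "?A \<in> sets \<mu>"
    using P by measurable
  have "AE t in \<nu>. emeasure (\<kappa> t) ?A = 0"
  proof (rule AE_mp[OF AE], rule AE_I2, rule impI)
    fix t assume t: "t \<in> space \<nu>" "AE y in \<kappa> t. P y"
    then show "emeasure (\<kappa> t) ?A = 0"
      using A by (subst (asm) AE_iff_measurable[of ?A]) (auto simp: sets_kernel space_kernel)
  qed
  then have "emeasure \<mu> ?A = 0"
    using A by (simp add: emeasure_disintegration nn_integral_0_iff_AE)
  then show ?thesis
    using A by (subst AE_iff_measurable[of ?A]) auto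
qed

text \<open>If \<open>t\<close> lies outside a null set \<open>N\<close>, then
  \<open>\<kappa> t\<close> is concentrated on points with \<open>T y = t\<close>, hence off the
  preimage of \<open>N\<close>. In other words, the image of \<mu> under \<open>T\<close> is
  absolutely continuous with respect to \<nu>.\<close>

lemma AE_statistic:
  assumes "AE t in \<nu>. P t"
  shows "AE x in \<mu>. P (T x)"
proof -
  from assms obtain N where N: "{t \<in> space \<nu>. \<not> P t} \<subseteq> N" "N \<in> sets \<nu>" "emeasure \<nu> N = 0"
    by (auto elim: AE_E)
  have null: "AE t in \<nu>. t \<notin> N"
    using N by (intro AE_not_in) auto
  have "AE x in \<mu>. T x \<notin> N"
  proof (rule AE_kernel_imp_AE)
    show "Measurable.pred \<mu> (\<lambda>x. T x \<notin> N)"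
      using N by measurable
    show "AE t in \<nu>. AE y in \<kappa> t. T y \<notin> N"
    proof (rule AE_mp[OF null], rule AE_I2, rule impI)
      fix t assume "t \<in> space \<nu>" "t \<notin> N"
      then show "AE y in \<kappa> t. T y \<notin> N"
        using AE_kernel_fibre[of t] by auto
    qed
  qed
  then show ?thesis
  proof (rule AE_mp, intro AE_I2 impI)
    fix x assume "x \<in> space \<mu>" "T x \<notin> N"
    then show "P (T x)"
      using N measurable_space[OF T_measurable] by auto
  qed
qed

text \<open>The Bochner integral defaults to 0 where \<open>h\<close> is not integrable, so it is
  written as a case distinction on the fibre integral of \<open>|h|\<close>, built from measurable
  nonnegative integrals.\<close>

lemma integral_kernel_measurable:
  fixes h :: "'a \<Rightarrow> real"
  assumes h: "h \<in> borel_measurable \<mu>"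
  shows "(\<lambda>t. LINT y|\<kappa> t. h y) \<in> borel_measurable \<nu>"
proof -
  note [measurable] = h nn_integral_disintegration(1)
  have "(LINT y|\<kappa> t. h y) = (if (\<integral>\<^sup>+y. ennreal \<bar>h y\<bar> \<partial>\<kappa> t) < \<infinity>
      then enn2real (\<integral>\<^sup>+y. ennreal (h y) \<partial>\<kappa> t) - enn2real (\<integral>\<^sup>+y. ennreal (- h y) \<partial>\<kappa> t) else 0)"
    if "t \<in> space \<nu>" for t
    using measurable_kernel[OF that h]
    by (auto simp: real_lebesgue_integral_def integrable_iff_bounded not_integrable_integral_eq)
  then have "(\<lambda>t. LINT y|\<kappa> t. h y) \<in> borel_measurable \<nu> \<longleftrightarrow>
      (\<lambda>t. if (\<integral>\<^sup>+y. ennreal \<bar>h y\<bar> \<partial>\<kappa> t) < \<infinity>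
      then enn2real (\<integral>\<^sup>+y. ennreal (h y) \<partial>\<kappa> t) - enn2real (\<integral>\<^sup>+y. ennreal (- h y) \<partial>\<kappa> t) else 0)
      \<in> borel_measurable \<nu>"
    by (rule measurable_cong)
  also have "\<dots>"
    by measurable
  finally show ?thesis .
qed

text \<open>Fubini's theorem along fibres: the finite integral of \<open>|h|\<close> bounds those of
  the positive and the negative part, and each part is disintegrated separately.\<close>

lemma integral_disintegration:
  fixes h :: "'a \<Rightarrow> real"
  assumes h: "integrable \<mu> h"
  shows "AE t in \<nu>. integrable (\<kappa> t) h"
    and "integrable \<nu> (\<lambda>t. LINT y|\<kappa> t. h y)"
    and "(LINT x|\<mu>. h x) = (LINT t|\<nu>. LINT y|\<kappa> t. h y)"
proof -
  note nn_integral_disintegration(1) [measurable]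
  have [measurable]: "h \<in> borel_measurable \<mu>" using h by auto
  have m: "\<And>t. t \<in> space \<nu> \<Longrightarrow> h \<in> borel_measurable (\<kappa> t)"
    by (rule measurable_kernel) auto
  let ?N = "\<lambda>t. \<integral>\<^sup>+y. ennreal \<bar>h y\<bar> \<partial>\<kappa> t"
  let ?P = "\<lambda>t. \<integral>\<^sup>+y. ennreal (h y) \<partial>\<kappa> t" and ?Q = "\<lambda>t. \<integral>\<^sup>+y. ennreal (- h y) \<partial>\<kappa> t"
  have fin: "(\<integral>\<^sup>+t. ?N t \<partial>\<nu>) < \<infinity>"
    using h by (simp add: nn_integral_disintegration(2)[symmetric] integrable_iff_bounded)
  then have "AE t in \<nu>. ?N t \<noteq> \<infinity>"
    by (intro nn_integral_noteq_infinite) auto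
  then show int: "AE t in \<nu>. integrable (\<kappa> t) h"
    by (rule AE_mp) (auto intro!: AE_I2 simp: integrable_iff_bounded m less_top)
  have le: "?P t \<le> ?N t" "?Q t \<le> ?N t" for t
    by (auto intro!: nn_integral_mono ennreal_leI)
  have finP: "(\<integral>\<^sup>+t. ?P t \<partial>\<nu>) < \<infinity>" and finQ: "(\<integral>\<^sup>+t. ?Q t \<partial>\<nu>) < \<infinity>"
    using fin by (auto intro: le_less_trans[OF nn_integral_mono[OF le(1)]] le_less_trans[OF nn_integral_mono[OF le(2)]])
  have eq: "AE t in \<nu>. (LINT y|\<kappa> t. h y) = enn2real (?P t) - enn2real (?Q t)"
    using int by (rule AE_mp) (auto intro!: AE_I2 simp: real_lebesgue_integral_def)
  have "integrable \<nu> (\<lambda>t. enn2real (?P t) - enn2real (?Q t))"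
    using finP finQ by (intro Bochner_Integration.integrable_diff integral_enn2real) auto
  moreover have "integrable \<nu> (\<lambda>t. LINT y|\<kappa> t. h y) \<longleftrightarrow>
      integrable \<nu> (\<lambda>t. enn2real (?P t) - enn2real (?Q t))"
    using eq by (intro integrable_cong_AE) (auto intro: integral_kernel_measurable)
  ultimately show "integrable \<nu> (\<lambda>t. LINT y|\<kappa> t. h y)" by simp
  have "(LINT t|\<nu>. LINT y|\<kappa> t. h y) = (LINT t|\<nu>. enn2real (?P t) - enn2real (?Q t))"
    using eq by (intro integral_cong_AE) (auto intro: integral_kernel_measurable)
  also have "\<dots> = enn2real (\<integral>\<^sup>+t. ?P t \<partial>\<nu>) - enn2real (\<integral>\<^sup>+t. ?Q t \<partial>\<nu>)"
    using finP finQ by (subst Bochner_Integration.integral_diff) (auto simp: integral_enn2real)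
  also have "\<dots> = (LINT x|\<mu>. h x)"
    using h by (simp add: real_lebesgue_integral_def nn_integral_disintegration(2))
  finally show "(LINT x|\<mu>. h x) = (LINT t|\<nu>. LINT y|\<kappa> t. h y)" by simp
qed

text \<open>A function of \<open>T\<close> is constant almost everywhere for
  \<open>\<kappa> t\<close>, so it leaves the fibre integral as a constant factor.\<close>

lemma integral_kernel_statistic:
  fixes h :: "'a \<Rightarrow> real"
  assumes t: "t \<in> space \<nu>" and u: "u \<in> borel_measurable \<nu>" and h: "h \<in> borel_measurable \<mu>"
  shows "(LINT y|\<kappa> t. u (T y) * h y) = u t * (LINT y|\<kappa> t. h y)"
proof -
  note u [measurable] h [measurable]
  have "(LINT y|\<kappa> t. u (T y) * h y) = (LINT y|\<kappa> t. u t * h y)"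
    using AE_kernel_fibre[OF t] by (intro integral_cong_AE measurable_kernel[OF t]) (measurable, auto)
  then show ?thesis by simp
qed

lemma nn_integral_kernel_statistic:
  fixes h :: "'a \<Rightarrow> ennreal"
  assumes t: "t \<in> space \<nu>" and h: "h \<in> borel_measurable \<mu>"
  shows "(\<integral>\<^sup>+y. u (T y) * h y \<partial>\<kappa> t) = u t * (\<integral>\<^sup>+y. h y \<partial>\<kappa> t)"
proof -
  have "(\<integral>\<^sup>+y. u (T y) * h y \<partial>\<kappa> t) = (\<integral>\<^sup>+y. u t * h y \<partial>\<kappa> t)"
    using AE_kernel_fibre[OF t] by (intro nn_integral_cong_AE) auto
  then show ?thesis
    using measurable_kernel[OF t h] by (simp add: nn_integral_cmult)
qed

section \<open>Weighted fibre means as conditional expectations\<close>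

context
  fixes f X :: "'a \<Rightarrow> real"
  assumes f: "integrable \<mu> f" and f_pos: "\<And>x. x \<in> space \<mu> \<Longrightarrow> 0 < f x"
    and X: "X \<in> borel_measurable \<mu>" and Xf: "integrable \<mu> (\<lambda>x. X x * f x)"
begin

text \<open>Bayes' formula for the mean of \<open>X\<close> on a fibre under the measure with
  density \<open>f\<close>. Where the denominator vanishes the value is 0, by the convention for
  division.\<close>

definition fibre_mean :: "'t \<Rightarrow> real" where
  "fibre_mean t = (LINT y|\<kappa> t. X y * f y) / (LINT y|\<kappa> t. f y)"

lemma f_measurable [measurable]: "f \<in> borel_measurable \<mu>"
  using f by auto

lemma Xf_measurable [measurable]: "(\<lambda>x. X x * f x) \<in> borel_measurable \<mu>"
  using Xf by auto

lemma fibre_mean_measurable [measurable]: "fibre_mean \<in> borel_measurable \<nu>"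
  unfolding fibre_mean_def
  by (intro borel_measurable_divide integral_kernel_measurable) measurable

text \<open>A strictly positive integrable function has integral 0 only against the zero measure,
  for which every property holds almost everywhere. This settles the fibres on which
  \<open>fibre_mean\<close> divides by 0.\<close>

lemma integral_kernel_eq_0D:
  assumes t: "t \<in> space \<nu>" and int: "integrable (\<kappa> t) f" and 0: "(LINT y|\<kappa> t. f y) = 0"
  shows "AE y in \<kappa> t. P y"
proof -
  have "AE y in \<kappa> t. 0 \<le> f y"
    using t f_pos by (intro AE_I2) (auto simp: space_kernel less_imp_le)
  then have "AE y in \<kappa> t. f y = 0"
    using int 0 integral_nonneg_eq_0_iff_AE by blast
  moreover have "AE y in \<kappa> t. 0 < f y"
    using t f_pos by (intro AE_I2) (auto simp: space_kernel)
  ultimately show ?thesis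
    by eventually_elim simp
qed

text \<open>Clears the denominator of \<open>fibre_mean\<close>: if it is 0, the kernel is the zero
  measure and the numerator vanishes as well.\<close>

lemma AE_fibre_mean_mult:
  "AE t in \<nu>. integrable (\<kappa> t) f \<and> fibre_mean t * (LINT y|\<kappa> t. f y) = (LINT y|\<kappa> t. X y * f y)"
proof (rule AE_mp[OF integral_disintegration(1)[OF f]], rule AE_I2, rule impI)
  fix t assume t: "t \<in> space \<nu>" "integrable (\<kappa> t) f"
  show "integrable (\<kappa> t) f \<and> fibre_mean t * (LINT y|\<kappa> t. f y) = (LINT y|\<kappa> t. X y * f y)"
  proof (cases "(LINT y|\<kappa> t. f y) = 0")
    case True
    have "(LINT y|\<kappa> t. X y * f y) = 0"
      by (rule integral_eq_zero_AE, rule integral_kernel_eq_0D[OF t True])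
    with True t show ?thesis by simp
  next
    case False
    with t show ?thesis by (simp add: fibre_mean_def)
  qed
qed

text \<open>Fibres on which \<open>f\<close> integrates to 0 have null kernels and so contribute
  nothing to \<mu>.\<close>

lemma AE_fibre_integral_nonzero: "AE x in \<mu>. (LINT y|\<kappa> (T x). f y) \<noteq> 0"
proof (rule AE_kernel_imp_AE)
  have [measurable]: "(\<lambda>t. LINT y|\<kappa> t. f y) \<in> borel_measurable \<nu>"
    by (intro integral_kernel_measurable) measurable
  show "Measurable.pred \<mu> (\<lambda>x. (LINT y|\<kappa> (T x). f y) \<noteq> 0)"
    by measurable
  show "AE t in \<nu>. AE z in \<kappa> t. (LINT y|\<kappa> (T z). f y) \<noteq> 0"
  proof (rule AE_mp[OF integral_disintegration(1)[OF f]], rule AE_I2, rule impI)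
    fix t assume t: "t \<in> space \<nu>" "integrable (\<kappa> t) f"
    show "AE z in \<kappa> t. (LINT y|\<kappa> (T z). f y) \<noteq> 0"
    proof (cases "(LINT y|\<kappa> t. f y) = 0")
      case True
      then show ?thesis by (rule integral_kernel_eq_0D[OF t])
    next
      case False
      then show ?thesis using AE_kernel_fibre[OF t(1)] by auto
    qed
  qed
qed

text \<open>For almost every \<open>t\<close>, the integral of \<open>|fibre_mean t| * f\<close>
  over the fibre is the absolute value of the fibre integral of \<open>X f\<close>, and the latter
  is integrable over \<nu> by \<open>integral_disintegration\<close>.\<close>

lemma integrable_fibre_mean: "integrable \<mu> (\<lambda>x. fibre_mean (T x) * f x)"
proof (rule integrableI_bounded)
  show "(\<lambda>x. fibre_mean (T x) * f x) \<in> borel_measurable \<mu>" by measurable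
  have "(\<integral>\<^sup>+x. ennreal (norm (fibre_mean (T x) * f x)) \<partial>\<mu>)
      = (\<integral>\<^sup>+x. ennreal \<bar>fibre_mean (T x)\<bar> * ennreal (f x) \<partial>\<mu>)"
    using f_pos by (intro nn_integral_cong) (auto simp: abs_mult ennreal_mult'[symmetric] less_imp_le)
  also have "\<dots> = (\<integral>\<^sup>+t. (\<integral>\<^sup>+y. ennreal \<bar>fibre_mean (T y)\<bar> * ennreal (f y) \<partial>\<kappa> t) \<partial>\<nu>)"
    by (intro nn_integral_disintegration) measurable
  also have "\<dots> = (\<integral>\<^sup>+t. ennreal \<bar>fibre_mean t\<bar> * (\<integral>\<^sup>+y. ennreal (f y) \<partial>\<kappa> t) \<partial>\<nu>)"
    by (intro nn_integral_cong nn_integral_kernel_statistic) measurable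
  also have "\<dots> = (\<integral>\<^sup>+t. ennreal (norm (LINT y|\<kappa> t. X y * f y)) \<partial>\<nu>)"
  proof (rule nn_integral_cong_AE, rule AE_mp[OF AE_fibre_mean_mult], rule AE_I2, rule impI)
    fix t assume t: "t \<in> space \<nu>" and
      *: "integrable (\<kappa> t) f \<and> fibre_mean t * (LINT y|\<kappa> t. f y) = (LINT y|\<kappa> t. X y * f y)"
    have pos: "AE y in \<kappa> t. 0 \<le> f y"
      using t f_pos by (intro AE_I2) (auto simp: space_kernel less_imp_le)
    then have "(\<integral>\<^sup>+y. ennreal (f y) \<partial>\<kappa> t) = ennreal (LINT y|\<kappa> t. f y)"
      using * by (intro nn_integral_eq_integral) auto
    moreover have "norm (LINT y|\<kappa> t. X y * f y) = \<bar>fibre_mean t\<bar> * (LINT y|\<kappa> t. f y)"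
      using * integral_nonneg_AE[OF pos] by (simp add: abs_mult flip: conjunct2[OF *])
    ultimately show "ennreal \<bar>fibre_mean t\<bar> * (\<integral>\<^sup>+y. ennreal (f y) \<partial>\<kappa> t)
        = ennreal (norm (LINT y|\<kappa> t. X y * f y))"
      by (simp add: ennreal_mult')
  qed
  also have "\<dots> < \<infinity>"
    using integral_disintegration(2)[OF Xf] by (simp add: integrable_iff_bounded)
  finally show "(\<integral>\<^sup>+x. ennreal (norm (fibre_mean (T x) * f x)) \<partial>\<mu>) < \<infinity>" .
qed

text \<open>On each fibre the indicator and the mean are constants, and the mean times the fibre
  integral of \<open>f\<close> restores that of \<open>X f\<close>. This is the averaging identity
  that characterises a conditional expectation given \<open>T\<close>.\<close>

lemma integral_fibre_mean:
  assumes B: "B \<in> sets \<nu>"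
  shows "(LINT x|\<mu>. indicator B (T x) * (fibre_mean (T x) * f x))
    = (LINT x|\<mu>. indicator B (T x) * (X x * f x))"
proof -
  note B [measurable]
  have ind: "integrable \<mu> (\<lambda>x. indicator B (T x) * h x)" if "integrable \<mu> h" for h :: "'a \<Rightarrow> real"
  proof -
    have "integrable \<mu> (\<lambda>x. indicator (T -` B \<inter> space \<mu>) x *\<^sub>R h x)"
      using that by (intro integrable_mult_indicator) measurable
    then show ?thesis
      by (rule Bochner_Integration.integrable_cong[THEN iffD1, rotated 2]) (auto simp: indicator_def)
  qed
  have meas: "indicator B \<in> borel_measurable \<nu>" "(\<lambda>x. fibre_mean (T x) * f x) \<in> borel_measurable \<mu>"
    by measurable
  have [measurable]: "(\<lambda>t. LINT y|\<kappa> t. f y) \<in> borel_measurable \<nu>"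
      "(\<lambda>t. LINT y|\<kappa> t. X y * f y) \<in> borel_measurable \<nu>"
    by (intro integral_kernel_measurable f_measurable Xf_measurable)+
  have "(LINT x|\<mu>. indicator B (T x) * (fibre_mean (T x) * f x))
      = (LINT t|\<nu>. LINT y|\<kappa> t. indicator B (T y) * (fibre_mean (T y) * f y))"
    by (intro integral_disintegration ind integrable_fibre_mean)
  also have "\<dots> = (LINT t|\<nu>. indicator B t * (fibre_mean t * (LINT y|\<kappa> t. f y)))"
    by (intro Bochner_Integration.integral_cong refl)
      (simp add: integral_kernel_statistic[OF _ meas]
        integral_kernel_statistic[OF _ fibre_mean_measurable f_measurable])
  also have "\<dots> = (LINT t|\<nu>. indicator B t * (LINT y|\<kappa> t. X y * f y))"
    using AE_fibre_mean_mult by (intro integral_cong_AE) (measurable, auto)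
  also have "\<dots> = (LINT t|\<nu>. LINT y|\<kappa> t. indicator B (T y) * (X y * f y))"
    by (intro Bochner_Integration.integral_cong refl)
      (simp add: integral_kernel_statistic[OF _ meas(1) Xf_measurable])
  also have "\<dots> = (LINT x|\<mu>. indicator B (T x) * (X x * f x))"
    by (intro integral_disintegration(3)[symmetric] ind Xf)
  finally show ?thesis .
qed

text \<open>The sigma-algebra generated by \<open>T\<close> consists of the preimages of sets of
  \<nu>, so \<open>integral_fibre_mean\<close> checks the averaging identity on all of it, and
  uniqueness of conditional expectations applies.\<close>

lemma fibre_mean_real_cond_exp:
  "AE x in density \<mu> (\<lambda>x. ennreal (f x)).
     real_cond_exp (density \<mu> (\<lambda>x. ennreal (f x))) (vimage_algebra (space \<mu>) T \<nu>) X x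
       = fibre_mean (T x)"
proof -
  define P where "P = density \<mu> (\<lambda>x. ennreal (f x))"
  define F where "F = vimage_algebra (space \<mu>) T \<nu>"
  have T: "T \<in> space \<mu> \<rightarrow> space \<nu>"
    using measurable_space[OF T_measurable] by auto
  have F: "subalgebra P F"
    using sets_image_in_sets[OF refl T_measurable] by (simp add: subalgebra_def P_def F_def)
  \<comment> \<open>The total mass is the integral of \<open>f\<close>, which need not be 1 here;
    what follows relies on its finiteness.\<close>
  have "emeasure P (space P) = ennreal (LINT x|\<mu>. f x)"
    using f f_pos by (auto simp: P_def emeasure_density nn_integral_eq_integral less_imp_le cong: nn_integral_cong)
  then have fin: "finite_measure P"
    by (intro finite_measureI) simp
  interpret P: finite_measure_subalgebra P F
    by (intro finite_measure_subalgebra.intro finite_measure_subalgebra_axioms.intro F fin)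
  have pos: "AE x in \<mu>. 0 \<le> f x"
    using f_pos by (auto intro!: AE_I2 less_imp_le)
  have "AE x in P. real_cond_exp P F X x = fibre_mean (T x)"
  proof (rule P.real_cond_exp_charact)
    show "integrable P X" "integrable P (\<lambda>x. fibre_mean (T x))"
      using Xf integrable_fibre_mean X pos
      by (simp_all add: P_def integrable_density mult.commute)
    have "T \<in> measurable F \<nu>"
      unfolding F_def by (rule measurable_vimage_algebra1[OF T])
    then show "(\<lambda>x. fibre_mean (T x)) \<in> borel_measurable F"
      by measurable
    fix A assume "A \<in> sets F"
    then obtain B where B: "B \<in> sets \<nu>" and A: "A = T -` B \<inter> space \<mu>"
      unfolding F_def sets_vimage_algebra2[OF T] by auto
    note B [measurable]
    have [measurable]: "A \<in> sets \<mu>" unfolding A by measurable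
    have "(LINT x:A|P. Y x) = (LINT x|\<mu>. indicator B (T x) * (Y x * f x))"
      if [measurable]: "Y \<in> borel_measurable \<mu>" for Y :: "'a \<Rightarrow> real"
      unfolding P_def set_lebesgue_integral_def using pos
      by (subst integral_density) (auto simp: A indicator_def intro!: Bochner_Integration.integral_cong)
    then show "(LINT x:A|P. X x) = (LINT x:A|P. fibre_mean (T x))"
      using X by (simp add: integral_fibre_mean[OF B])
  qed
  then show ?thesis unfolding P_def F_def .
qed

text \<open>
  No measurability of \<open>g\<close> is available here, so uniqueness of conditional expectations does not
  apply; the argument works on the individual fibres, where \<open>g \<circ> T\<close> is constant.
\<close>

lemma AE_eq_fibre_mean:
  assumes "AE x in \<mu>. X x = g (T x)"
  shows "AE x in \<mu>. X x = fibre_mean (T x)"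
proof -
  have "AE t in \<nu>. (LINT y|\<kappa> t. f y) \<noteq> 0 \<longrightarrow> fibre_mean t = g t"
  proof (rule AE_mp[OF AE_kernel[OF assms]], rule AE_I2, rule impI)
    fix t assume t: "t \<in> space \<nu>" and *: "AE y in \<kappa> t. X y = g (T y)"
    have "(LINT y|\<kappa> t. X y * f y) = (LINT y|\<kappa> t. g t * f y)"
      using * AE_kernel_fibre[OF t]
      by (intro integral_cong_AE measurable_kernel[OF t]) (measurable, auto)
    then show "(LINT y|\<kappa> t. f y) \<noteq> 0 \<longrightarrow> fibre_mean t = g t"
      by (simp add: fibre_mean_def)
  qed
  \<comment> \<open>The identity moves from values \<open>t\<close> to sample points. Null fibres,
    on which \<open>fibre_mean\<close> is 0 whatever \<open>g\<close> is, are excluded because they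
    carry no mass.\<close>
  from AE_statistic[OF this] AE_fibre_integral_nonzero assms show ?thesis
    by eventually_elim simp
qed

end

end

section \<open>Conditional densities and sufficiency in the deformed family\<close>

text \<open>Since \<open>\<kappa> t\<close> lives on the fibre, the restriction in
  \<open>deformed_statistic_pdf\<close> and the case distinction in \<open>deformed_cond_pdf\<close>
  disappear. The quotient that remains is \<open>fibre_mean\<close> for the deformed
  density.\<close>

lemma deformed_cond_exp_eq_fibre_mean:
  fixes p :: "real \<Rightarrow> real \<Rightarrow> real"
  assumes fib: "fibre_integration (sample_measure M n) T \<nu> \<kappa>" and t: "t \<in> space \<nu>"
    and f: "integrable (sample_measure M n) (deformed_pdf \<alpha> M n p \<theta>)"
    and X: "X \<in> borel_measurable (sample_measure M n)"
  shows "deformed_cond_exp \<alpha> M n p T \<kappa> \<theta> X t =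
    (LINT y|\<kappa> t. X y * deformed_pdf \<alpha> M n p \<theta> y) / (LINT y|\<kappa> t. deformed_pdf \<alpha> M n p \<theta> y)"
proof -
  interpret disintegration "sample_measure M n" T \<nu> \<kappa>
    by (rule disintegration.intro[OF fib])
  let ?f = "deformed_pdf \<alpha> M n p \<theta>" and ?A = "fibre (sample_measure M n) T t"
  have [measurable]: "?f \<in> borel_measurable (\<kappa> t)" "X \<in> borel_measurable (\<kappa> t)"
    using f X by (auto intro: measurable_kernel[OF t])
  have "?A \<in> sets (sample_measure M n)"
  proof -
    have "T -` {t} \<inter> space (sample_measure M n) \<in> sets (sample_measure M n)"
      using fib t by (intro measurable_sets[OF T_measurable]) (auto simp: fibre_integration_def)
    moreover have "T -` {t} \<inter> space (sample_measure M n) = ?A"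
      by (auto simp: fibre_def)
    ultimately show ?thesis by simp
  qed
  then have [measurable]: "?A \<in> sets (\<kappa> t)"
    by (simp only: sets_kernel[OF t])
  have A: "AE y in \<kappa> t. y \<in> ?A"
    using AE_kernel_fibre[OF t] AE_space by eventually_elim (auto simp: fibre_def space_kernel[OF t])
  have statistic: "deformed_statistic_pdf \<alpha> M n p T \<kappa> \<theta> t = (LINT y|\<kappa> t. ?f y)"
    unfolding deformed_statistic_pdf_def set_lebesgue_integral_def
    using A by (intro integral_cong_AE) (measurable, auto)
  have "deformed_cond_exp \<alpha> M n p T \<kappa> \<theta> X t
      = (LINT y|\<kappa> t. X y * (if y \<in> ?A then ?f y / (LINT y|\<kappa> t. ?f y) else 0))"
    by (simp only: deformed_cond_exp_def deformed_cond_pdf_def statistic)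
  also have "\<dots> = (LINT y|\<kappa> t. X y * ?f y / (LINT y|\<kappa> t. ?f y))"
    using A by (intro integral_cong_AE) (measurable, auto)
  finally show ?thesis by simp
qed

text \<open>The deformed density is the exponential of the likelihood up to a factor free of the
  sample, so sufficiency makes the ratio of its values at two points of a fibre the same for all
  parameters. Comparison with one base point \<open>x\<close> of the fibre gives \<open>r\<close>,
  which may depend on \<open>t\<close>.\<close>

lemma jones_sufficient_deformed_pdf_ratio:
  assumes suff: "jones_sufficient \<alpha> M n p \<Theta> T" and \<theta>: "\<theta> \<in> \<Theta>" "\<theta>' \<in> \<Theta>"
    and pos: "\<And>x. 0 < deformed_pdf \<alpha> M n p \<theta> x" "\<And>x. 0 < deformed_pdf \<alpha> M n p \<theta>' x"
  obtains r where "r > 0"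
    "\<And>y. y \<in> fibre (sample_measure M n) T t \<Longrightarrow>
      deformed_pdf \<alpha> M n p \<theta> y = r * deformed_pdf \<alpha> M n p \<theta>' y"
proof (cases "fibre (sample_measure M n) T t = {}")
  case True
  then show ?thesis using that[of 1] by simp
next
  case False
  then obtain x where x: "x \<in> fibre (sample_measure M n) T t" by auto
  let ?J = "jones_likelihood \<alpha> M n p" and ?f = "deformed_pdf \<alpha> M n p"
  show ?thesis
  proof (rule that[of "?f \<theta> x / ?f \<theta>' x"])
    show "?f \<theta> x / ?f \<theta>' x > 0" using pos by simp
    fix y assume "y \<in> fibre (sample_measure M n) T t"
    then have "y \<in> space (sample_measure M n)" "x \<in> space (sample_measure M n)" "T y = T x"
      using x by (auto simp: fibre_def)
    then obtain c where "\<forall>\<theta>\<in>\<Theta>. ?J y \<theta> - ?J x \<theta> = c"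
      using suff unfolding jones_sufficient_def by blast
    then have "?J y \<theta> = ?J x \<theta> + c" "?J y \<theta>' = ?J x \<theta>' + c"
      using \<theta> by (auto simp: algebra_simps)
    then have "?f \<theta> y = ?f \<theta> x * exp c" "?f \<theta>' y = ?f \<theta>' x * exp c"
      by (simp_all add: deformed_pdf_def exp_add)
    then show "?f \<theta> y = ?f \<theta> x / ?f \<theta>' x * ?f \<theta>' y"
      using pos(2)[of x] by simp
  qed
qed

text \<open>The factor \<open>r\<close> cancels between the density and its fibre integral. This
  works for every \<open>t\<close>, not only almost every one: as \<open>r\<close> is positive, the
  fibre integrals at both parameters vanish together.\<close>

lemma jones_sufficient_deformed_cond_exp_eq:
  assumes "jones_sufficient \<alpha> M n p \<Theta> T" and "\<theta> \<in> \<Theta>" "\<theta>' \<in> \<Theta>"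
    and "\<And>x. 0 < deformed_pdf \<alpha> M n p \<theta> x" "\<And>x. 0 < deformed_pdf \<alpha> M n p \<theta>' x"
  shows "deformed_cond_exp \<alpha> M n p T \<kappa> \<theta> X t = deformed_cond_exp \<alpha> M n p T \<kappa> \<theta>' X t"
proof -
  let ?f = "deformed_pdf \<alpha> M n p" and ?A = "fibre (sample_measure M n) T t"
  obtain r where r: "r > 0" "\<And>y. y \<in> ?A \<Longrightarrow> ?f \<theta> y = r * ?f \<theta>' y"
    using jones_sufficient_deformed_pdf_ratio[OF assms, where t = t] by blast
  have "deformed_statistic_pdf \<alpha> M n p T \<kappa> \<theta> t = (LINT y|\<kappa> t. r * (indicator ?A y *\<^sub>R ?f \<theta>' y))"
    unfolding deformed_statistic_pdf_def set_lebesgue_integral_def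
    using r by (intro Bochner_Integration.integral_cong) (auto simp: indicator_def)
  then have "deformed_statistic_pdf \<alpha> M n p T \<kappa> \<theta> t = r * deformed_statistic_pdf \<alpha> M n p T \<kappa> \<theta>' t"
    by (simp add: deformed_statistic_pdf_def set_lebesgue_integral_def)
  then have "deformed_cond_pdf \<alpha> M n p T \<kappa> \<theta> y t = deformed_cond_pdf \<alpha> M n p T \<kappa> \<theta>' y t" for y
    using r by (simp add: deformed_cond_pdf_def)
  then show ?thesis
    by (simp add: deformed_cond_exp_def)
qed

section \<open>Positivity of the deformed density\<close>

lemma emeasure_sample_measure_nonzero:
  assumes "sigma_finite_measure M" and "emeasure M (space M) \<noteq> 0"
  shows "emeasure (sample_measure M n) (space (sample_measure M n)) \<noteq> 0"
proof -
  interpret product_sigma_finite "\<lambda>_::nat. M"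
    using assms(1) by (rule product_sigma_finite.intro)
  have "emeasure (sample_measure M n) (\<Pi>\<^sub>E i\<in>{..<n}. space M) = (\<Prod>i<n. emeasure M (space M))"
    by (rule emeasure_PiM) auto
  then show ?thesis
    using assms(2) by (simp add: space_PiM)
qed

text \<open>The integral of an exponential over a nonzero measure is positive once it exists. A
  divergent normalising integral would default to 0 and make the density vanish.\<close>

lemma deformed_pdf_pos:
  assumes int: "integrable (sample_measure M n) (\<lambda>x. exp (jones_likelihood \<alpha> M n p x \<theta>))"
    and nz: "emeasure (sample_measure M n) (space (sample_measure M n)) \<noteq> 0"
  shows "0 < deformed_pdf \<alpha> M n p \<theta> x"
proof -
  let ?\<mu> = "sample_measure M n"
  let ?Z = "LINT x|?\<mu>. exp (jones_likelihood \<alpha> M n p x \<theta>)"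
  have "?Z \<noteq> 0"
  proof
    assume "?Z = 0"
    then have "AE x in ?\<mu>. exp (jones_likelihood \<alpha> M n p x \<theta>) = 0"
      using int by (subst (asm) integral_nonneg_eq_0_iff_AE) auto
    then have "AE x in ?\<mu>. False" by simp
    then show False
      using nz by (simp add: AE_iff_measurable[OF sets.top])
  qed
  moreover have "?Z \<ge> 0" by simp
  ultimately have "0 < ?Z" by linarith
  then show ?thesis
    by (simp add: deformed_pdf_def)
qed

section \<open>The conditioned estimator, its mean and its variance\<close>

theorem theorem18:
  fixes \<alpha> :: real and n :: nat
    and S \<Theta> :: "real set"
    and M :: "real measure"
    and p :: "real \<Rightarrow> real \<Rightarrow> real"
    and T :: "(nat \<Rightarrow> real) \<Rightarrow> 't"
    and \<nu> :: "'t measure"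
    and \<kappa> :: "'t \<Rightarrow> (nat \<Rightarrow> real) measure"
    and est :: "(nat \<Rightarrow> real) \<Rightarrow> real"
    and \<tau> :: "real \<Rightarrow> real"
  assumes "\<alpha> > 0" and "\<alpha> \<noteq> 1" and "n > 0"
    and reference_measure:
      "S \<in> sets borel \<and> M = restrict_space lborel S \<or> countable S \<and> M = count_space S"
    and probability_family:
      "\<And>\<theta>. \<theta> \<in> \<Theta> \<Longrightarrow> p \<theta> \<in> borel_measurable M"
      "\<And>\<theta> x. \<theta> \<in> \<Theta> \<Longrightarrow> 0 \<le> p \<theta> x"
      "\<And>\<theta>. \<theta> \<in> \<Theta> \<Longrightarrow> prob_space (density M (\<lambda>x. ennreal (p \<theta> x)))"
    and common_support: "\<And>\<theta>. \<theta> \<in> \<Theta> \<Longrightarrow> {x. p \<theta> x \<noteq> 0} = S"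
    and finite_denominator:
      "\<And>\<theta>. \<theta> \<in> \<Theta> \<Longrightarrow> integrable (sample_measure M n) (\<lambda>x. exp (jones_likelihood \<alpha> M n p x \<theta>))"
    and fibres: "fibre_integration (sample_measure M n) T \<nu> \<kappa>"
    and sufficient: "jones_sufficient \<alpha> M n p \<Theta> T"
    and estimator: "est \<in> borel_measurable (sample_measure M n)"
    and unbiased:
      "\<And>\<theta>. \<theta> \<in> \<Theta> \<Longrightarrow> integrable (deformed_dist \<alpha> M n p \<theta>) est"
      "\<And>\<theta>. \<theta> \<in> \<Theta> \<Longrightarrow> prob_space.expectation (deformed_dist \<alpha> M n p \<theta>) est = \<tau> \<theta>"
  shows "\<exists>\<phi>.
    (\<forall>\<theta>\<in>\<Theta>. \<forall>t \<in> T ` space (sample_measure M n).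
       \<phi> t = deformed_cond_exp \<alpha> M n p T \<kappa> \<theta> est t) \<and>
    (\<forall>\<theta>\<in>\<Theta>.
       integrable (deformed_dist \<alpha> M n p \<theta>) (\<lambda>x. \<phi> (T x)) \<and>
       prob_space.expectation (deformed_dist \<alpha> M n p \<theta>) (\<lambda>x. \<phi> (T x)) = \<tau> \<theta> \<and>
       (integrable (deformed_dist \<alpha> M n p \<theta>) (\<lambda>x. (est x)\<^sup>2) \<longrightarrow>
          integrable (deformed_dist \<alpha> M n p \<theta>) (\<lambda>x. (\<phi> (T x))\<^sup>2) \<and>
          prob_space.variance (deformed_dist \<alpha> M n p \<theta>) (\<lambda>x. \<phi> (T x))
            \<le> prob_space.variance (deformed_dist \<alpha> M n p \<theta>) est \<and>
          (prob_space.variance (deformed_dist \<alpha> M n p \<theta>) (\<lambda>x. \<phi> (T x))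
             = prob_space.variance (deformed_dist \<alpha> M n p \<theta>) est
           \<longleftrightarrow> (\<exists>g. AE x in sample_measure M n. est x = g (T x)))))"
proof (cases "\<Theta> = {}")
  case True
  then show ?thesis by simp
next
  case False
  \<comment> \<open>This fixes the parameter at which \<phi> is computed; sufficiency shows that any
    other gives the same function.\<close>
  then obtain \<theta>\<^sub>0 where \<theta>\<^sub>0: "\<theta>\<^sub>0 \<in> \<Theta>" by auto
  let ?\<mu> = "sample_measure M n" and ?f = "deformed_pdf \<alpha> M n p"
  interpret disintegration ?\<mu> T \<nu> \<kappa>
    by (rule disintegration.intro[OF fibres])
  have "sigma_finite_measure M"
    using reference_measure
    by (auto intro: sigma_finite_measure_restrict_space sigma_finite_lborel sigma_finite_measure_count_space_countable)
  moreover have "emeasure M (space M) \<noteq> 0"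
  proof
    assume 0: "emeasure M (space M) = 0"
    have "emeasure (density M (\<lambda>x. ennreal (p \<theta>\<^sub>0 x))) (space M) = 0"
      using probability_family(1)[OF \<theta>\<^sub>0] AE_iff_measurable[OF sets.top, of M "\<lambda>_. False"] 0
      by (subst emeasure_density) (auto simp: nn_integral_0_iff_AE)
    then show False
      using prob_space.emeasure_space_1[OF probability_family(3)[OF \<theta>\<^sub>0]] by simp
  qed
  ultimately have "emeasure ?\<mu> (space ?\<mu>) \<noteq> 0"
    by (rule emeasure_sample_measure_nonzero)
  then have pos: "0 < ?f \<theta> x" if "\<theta> \<in> \<Theta>" for \<theta> x
    using finite_denominator[OF that] by (intro deformed_pdf_pos)
  have int: "integrable ?\<mu> (?f \<theta>)" if "\<theta> \<in> \<Theta>" for \<theta>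
    using finite_denominator[OF that] by (simp add: deformed_pdf_def[abs_def])
  have one: "(LINT x|?\<mu>. ?f \<theta> x) = 1" if "\<theta> \<in> \<Theta>" for \<theta>
  proof -
    \<comment> \<open>A vanishing normalising integral would make the density 0 at every point by
      the convention for division, against positivity at an arbitrary point.\<close>
    have "(LINT x|?\<mu>. exp (jones_likelihood \<alpha> M n p x \<theta>)) \<noteq> 0"
      using pos[OF that, of undefined] by (auto simp: deformed_pdf_def)
    then show ?thesis by (simp add: deformed_pdf_def)
  qed
  define \<phi> where "\<phi> = deformed_cond_exp \<alpha> M n p T \<kappa> \<theta>\<^sub>0 est"
  have \<phi>: "\<phi> t = deformed_cond_exp \<alpha> M n p T \<kappa> \<theta> est t" if "\<theta> \<in> \<Theta>" for \<theta> t
    unfolding \<phi>_def by (rule jones_sufficient_deformed_cond_exp_eq[OF sufficient \<theta>\<^sub>0 that pos[OF \<theta>\<^sub>0] pos[OF that]])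
  show ?thesis
  proof (intro exI[of _ \<phi>] conjI ballI impI)
    fix \<theta> t assume "\<theta> \<in> \<Theta>"
    then show "\<phi> t = deformed_cond_exp \<alpha> M n p T \<kappa> \<theta> est t" by (rule \<phi>)
  next
    fix \<theta> assume \<theta>: "\<theta> \<in> \<Theta>"
    define P where "P = deformed_dist \<alpha> M n p \<theta>"
    define F where "F = vimage_algebra (space ?\<mu>) T \<nu>"
    have P: "P = density ?\<mu> (\<lambda>x. ennreal (?f \<theta> x))"
      by (simp add: P_def deformed_dist_def)
    have [measurable]: "?f \<theta> \<in> borel_measurable ?\<mu>" using int[OF \<theta>] by auto
    interpret P: prob_space P
    proof
      show "emeasure P (space P) = 1"
        using int[OF \<theta>] one[OF \<theta>] pos[OF \<theta>]
        by (auto simp: P emeasure_density nn_integral_eq_integral less_imp_le cong: nn_integral_cong)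
    qed
    have Xf: "integrable ?\<mu> (\<lambda>x. est x * ?f \<theta> x)"
      using unbiased(1)[OF \<theta>] pos[OF \<theta>] estimator
      by (simp add: deformed_dist_def integrable_density less_imp_le mult.commute)
    note mean = int[OF \<theta>] pos[OF \<theta>] estimator Xf
    \<comment> \<open>Only values in \<open>space \<nu>\<close> are covered, since the kernels are
      unconstrained elsewhere; \<open>T\<close> maps samples into this set.\<close>
    have \<phi>_mean: "\<phi> t = fibre_mean (?f \<theta>) est t" if "t \<in> space \<nu>" for t
      using \<phi>[OF \<theta>] deformed_cond_exp_eq_fibre_mean[OF fibres that int[OF \<theta>] estimator]
      by (simp add: fibre_mean_def[OF mean])
    have T: "T \<in> space ?\<mu> \<rightarrow> space \<nu>"
      using measurable_space[OF T_measurable] by auto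
    have F: "subalgebra P F"
      using sets_image_in_sets[OF refl T_measurable] by (simp add: subalgebra_def P F_def)
    have "\<phi> \<in> borel_measurable \<nu>"
      using fibre_mean_measurable[OF mean] by (simp add: \<phi>_mean cong: measurable_cong)
    then have Y: "(\<lambda>x. \<phi> (T x)) \<in> borel_measurable F"
      unfolding F_def by (rule measurable_compose[OF measurable_vimage_algebra1[OF T]])
    \<comment> \<open>The density is strictly positive, so \<open>P\<close> and the sample measure
      have the same null sets. Hence the condition for equality can be stated without reference to
      the parameter.\<close>
    have AE_P: "(AE x in P. Q x) \<longleftrightarrow> (AE x in ?\<mu>. Q x)" for Q
      unfolding P using pos[OF \<theta>] by (subst AE_density) auto
    have cond: "AE x in P. real_cond_exp P F est x = \<phi> (T x)"
      using fibre_mean_real_cond_exp[OF mean] AE_space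
      unfolding P F_def by eventually_elim (simp add: \<phi>_mean funcset_mem[OF T])
    interpret sub: finite_measure_subalgebra P F
      by (intro finite_measure_subalgebra.intro finite_measure_subalgebra_axioms.intro F P.finite_measure_axioms)
    have est: "integrable P est" "P.expectation est = \<tau> \<theta>"
      unfolding P_def by (fact unbiased[OF \<theta>])+
    have YP: "(\<lambda>x. \<phi> (T x)) \<in> borel_measurable P"
      using F Y by (rule measurable_from_subalg)
    have "integrable P (\<lambda>x. \<phi> (T x)) \<longleftrightarrow> integrable P (real_cond_exp P F est)"
      using cond YP by (intro integrable_cong_AE) auto
    then show "integrable (deformed_dist \<alpha> M n p \<theta>) (\<lambda>x. \<phi> (T x))"
      using sub.real_cond_exp_int(1)[OF est(1)] unfolding P_def by simp
    have "P.expectation (\<lambda>x. \<phi> (T x)) = P.expectation (real_cond_exp P F est)"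
      using cond YP by (intro integral_cong_AE) auto
    then show "(LINT x|deformed_dist \<alpha> M n p \<theta>. \<phi> (T x)) = \<tau> \<theta>"
      using sub.real_cond_exp_int(2)[OF est(1)] est(2) unfolding P_def by simp
    \<comment> \<open>Without a finite second moment the variance of \<open>est\<close> would
      default to 0 and the comparison would lose its meaning.\<close>
    assume "integrable (deformed_dist \<alpha> M n p \<theta>) (\<lambda>x. (est x)\<^sup>2)"
    then have est2: "integrable P (\<lambda>x. (est x)\<^sup>2)" unfolding P_def .
    note rb = P.rao_blackwell[OF F Y cond est(1) est2]
    show "integrable (deformed_dist \<alpha> M n p \<theta>) (\<lambda>x. (\<phi> (T x))\<^sup>2)"
      using rb(1) unfolding P_def .
    show "prob_space.variance (deformed_dist \<alpha> M n p \<theta>) (\<lambda>x. \<phi> (T x))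
        \<le> prob_space.variance (deformed_dist \<alpha> M n p \<theta>) est"
      using rb(2) unfolding P_def .
    \<comment> \<open>The equality case of \<open>rao_blackwell\<close> concerns \<phi> itself; an
      arbitrary, possibly nonmeasurable \<open>g\<close> is reduced to it by
      \<open>AE_eq_fibre_mean\<close>.\<close>
    have "(AE x in ?\<mu>. est x = \<phi> (T x)) \<longleftrightarrow> (\<exists>g. AE x in ?\<mu>. est x = g (T x))"
    proof
      assume "\<exists>g. AE x in ?\<mu>. est x = g (T x)"
      then obtain g where "AE x in ?\<mu>. est x = g (T x)" ..
      from AE_eq_fibre_mean[OF mean this] AE_space
      show "AE x in ?\<mu>. est x = \<phi> (T x)"
        by eventually_elim (simp add: \<phi>_mean funcset_mem[OF T])
    qed (rule exI[of _ \<phi>])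
    then show "prob_space.variance (deformed_dist \<alpha> M n p \<theta>) (\<lambda>x. \<phi> (T x))
          = prob_space.variance (deformed_dist \<alpha> M n p \<theta>) est
        \<longleftrightarrow> (\<exists>g. AE x in ?\<mu>. est x = g (T x))"
      using rb(3) unfolding AE_P unfolding P_def by simp
  qed
qed

end
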